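(* Let $\alpha=\{k_1,\ldots,k_p\}$ be a homogeneous partition of $n$ with $p\ge 2$ blocks, i.e. $k_1=\cdots=k_p$ and $n=pk_1$. Then $$ \mathrm{dist}((\mathcal{FW}_{\alpha,2}^n)^*,\mathbb{S}^n_+) \geq \frac{1}{\sqrt{\frac{4n}{p^2} - \frac{4}{p}+1}}\cdot\frac{p-2}{p}. $$
   Context: $\mathbb{S}^n$ denotes the real symmetric $n\times n$ matrices and $\mathbb{S}^n_+$ the positive semidefinite (PSD) ones. A partition of $n$ is an ordered list $\alpha=\{k_1,\ldots,k_p\}$ of positive integers with $\sum_{i=1}^p k_i=n$; throughout $p\ge 2$. Let $E_i^\alpha\in\mathbb{R}^{k_i\times n}$ be the $i$-th block row of $I_n$ when the rows of $I_n$ are split consecutively into blocks of sizes $k_1,\ldots,k_p$, and for $i\neq j$ let $E_{ij}^\alpha=\begin{bmatrix}(E_i^\alpha)^{\mathsf T} & (E_j^\alpha)^{\mathsf T}\end{bmatrix}^{\mathsf T}\in\mathbb{R}^{(k_i+k_j)\times n}$. The set $\mathcal{FW}_{\alpha,2}^n$ of block factor-width-two matrices consists of all $Z\in\mathbb{S}^n$ of the form $Z=\sum_{i=1}^{p-1}\sum_{j=i+1}^p (E^{\alpha}_{ij})^{\mathsf T} X_{ij} E^{\alpha}_{ij}$ for some $X_{ij}\in\mathbb{S}^{k_i+k_j}_+$. Its dual with respect to the trace inner product is $(\mathcal{FW}_{\alpha,2}^n)^* = \{X \in \mathbb{S}^n \mid E^{\alpha}_{ij} X (E^{\alpha}_{ij})^{\mathsf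 T} \succeq 0,\ 1\leq i < j \leq p\}$. With $\|\cdot\|_F$ the Frobenius norm, for a matrix $M$ and a set $\mathcal{D}$ put $\mathrm{dist}(M,\mathcal{D})=\inf_{N\in\mathcal{D}}\|M-N\|_F$, and define $$\mathrm{dist}((\mathcal{FW}_{\alpha,2}^n)^*,\mathbb{S}^n_+)=\sup_{M \in (\mathcal{FW}_{\alpha,2}^n)^*,\ \|M\|_F = 1} \mathrm{dist}(M,\mathbb{S}^n_+).$$ *)

theory Defs
  imports Complex_Main "Jordan_Normal_Form.Matrix"
begin

definition sym_mats :: "nat \<Rightarrow> real mat set" where
  "sym_mats n = {A \<in> carrier_mat n n. transpose_mat A = A}"

definition psd_mats :: "nat \<Rightarrow> real mat set" where
  "psd_mats n = {A \<in> sym_mats n. \<forall>x \<in> carrier_vec n. 0 \<le> x \<bullet> (A *\<^sub>v x)}"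

definition partition_of :: "nat \<Rightarrow> nat list \<Rightarrow> bool" where
  "partition_of n \<alpha> \<longleftrightarrow> (\<forall>k \<in> set \<alpha>. 0 < k) \<and> sum_list \<alpha> = n"

definition homogeneous :: "nat list \<Rightarrow> bool" where
  "homogeneous \<alpha> \<longleftrightarrow> (\<forall>i < length \<alpha>. \<alpha> ! i = \<alpha> ! 0)"

text \<open>Blocks are indexed from 0, so block \<open>i\<close> consists of the rows of the identity matrix
  starting at row \<open>sum_list (take i \<alpha>)\<close>.\<close>

definition block_row :: "nat list \<Rightarrow> nat \<Rightarrow> real mat" where
  "block_row \<alpha> i = mat (\<alpha> ! i) (sum_list \<alpha>)
     (\<lambda>(r, c). 1\<^sub>m (sum_list \<alpha>) $$ (sum_list (take i \<alpha>) + r, c))"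

definition block_rows2 :: "nat list \<Rightarrow> nat \<Rightarrow> nat \<Rightarrow> real mat" where
  "block_rows2 \<alpha> i j = block_row \<alpha> i @\<^sub>r block_row \<alpha> j"

text \<open>The type of matrices of all dimensions carries no commutative monoid structure, hence the
  sum of matrices below is taken entrywise.\<close>

definition fw2 :: "nat list \<Rightarrow> real mat set" where
  "fw2 \<alpha> = {Z \<in> sym_mats (sum_list \<alpha>). \<exists>X :: nat \<Rightarrow> nat \<Rightarrow> real mat.
     (\<forall>j < length \<alpha>. \<forall>i < j. X i j \<in> psd_mats (\<alpha> ! i + \<alpha> ! j)) \<and>
     Z = mat (sum_list \<alpha>) (sum_list \<alpha>) (\<lambda>(r, c). \<Sum>j < length \<alpha>. \<Sum>i < j.
       (transpose_mat (block_rows2 \<alpha> i j) * X i j * block_rows2 \<alpha> i j) $$ (r, c))}"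

definition mat_trace :: "real mat \<Rightarrow> real" where
  "mat_trace A = (\<Sum>i < dim_row A. A $$ (i, i))"

definition dual_cone :: "nat \<Rightarrow> real mat set \<Rightarrow> real mat set" where
  "dual_cone n C = {X \<in> sym_mats n. \<forall>Z \<in> C. 0 \<le> mat_trace (X * Z)}"

definition frob_norm :: "real mat \<Rightarrow> real" where
  "frob_norm A = sqrt (\<Sum>i < dim_row A. \<Sum>j < dim_col A. (A $$ (i, j))\<^sup>2)"

definition mat_dist :: "real mat \<Rightarrow> real mat set \<Rightarrow> real" where
  "mat_dist M D = (INF N \<in> D. frob_norm (M - N))"

definition cone_dist :: "real mat set \<Rightarrow> real mat set \<Rightarrow> real" where
  "cone_dist C D = (SUP M \<in> {M \<in> C. frob_norm M = 1}. mat_dist M D)"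

lemma psd_fun_zero_diag:
  fixes A :: "nat \<Rightarrow> nat \<Rightarrow> real"
  assumes sym: "\<And>i j. A i j = A j i"
    and psd: "\<And>x. 0 \<le> (\<Sum>i<Suc n. \<Sum>j<Suc n. x i * A i j * x j)"
    and z: "A n n = 0" and k: "k < n"
  shows "A k n = 0"
proof (rule ccontr)
  assume nz: "A k n \<noteq> 0"
  have q: "0 \<le> A k k + 2 * s * A k n" for s
  proof -
    define x where "x = (\<lambda>i. if i = k then 1 else if i = n then s else (0::real))"
    have inner: "(\<Sum>j<Suc n. x i * A i j * x j) = x i * (A i k + s * A i n)" for i
    proof -
      have "(\<Sum>j<Suc n. x i * A i j * x j) = (\<Sum>j<n. x i * A i j * x j) + x i * A i n * s"
        using k by (simp add: x_def)
      also have "(\<Sum>j<n. x i * A i j * x j) = (\<Sum>j<n. if j = k then x i * A i j else 0)"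
        by (rule sum.cong) (auto simp: x_def)
      also have "\<dots> = x i * A i k" using k by simp
      finally show ?thesis by (simp add: algebra_simps)
    qed
    have "(\<Sum>i<Suc n. \<Sum>j<Suc n. x i * A i j * x j)
        = (\<Sum>i<n. x i * (A i k + s * A i n)) + s * (A n k + s * A n n)"
      unfolding inner using k by (simp add: x_def)
    also have "(\<Sum>i<n. x i * (A i k + s * A i n)) = (\<Sum>i<n. if i = k then A i k + s * A i n else 0)"
      by (rule sum.cong) (auto simp: x_def)
    also have "\<dots> = A k k + s * A k n" using k by simp
    finally show ?thesis using psd[of x] z sym[of n k] by simp
  qed
  show False using q[of "- (A k k + 1) / (2 * A k n)"] nz by (simp add: field_simps)
qed

lemma psd_fun_inner_nonneg:
  fixes A B :: "nat \<Rightarrow> nat \<Rightarrow> real"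
  assumes "\<And>i j. A i j = A j i"
    and "\<And>x. 0 \<le> (\<Sum>i<n. \<Sum>j<n. x i * A i j * x j)"
    and "\<And>x. 0 \<le> (\<Sum>i<n. \<Sum>j<n. x i * B i j * x j)"
  shows "0 \<le> (\<Sum>i<n. \<Sum>j<n. A i j * B i j)"
  using assms
proof (induction n arbitrary: A)
  case 0
  then show ?case by simp
next
  case (Suc n)
  define d where "d = A n n"
  define A' where "A' = (\<lambda>i j. A i j - A i n * A j n / d)"
  have d0: "A k n = 0" if "d = 0" "k \<le> n" for k
    using psd_fun_zero_diag[OF Suc.prems(1,2), where k=k] that unfolding d_def
    by (cases "k = n") auto
  have last: "A' i n = 0" "A' n i = 0" if "i \<le> n" for i
    using d0[of i] that Suc.prems(1)[of n i] unfolding A'_def d_def by (cases "A n n = 0"; simp)+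
  have sq: "(\<Sum>i<Suc n. \<Sum>j<Suc n. x i * (A i n * A j n / d) * x j) = (\<Sum>i<Suc n. A i n * x i)\<^sup>2 / d" for x
    unfolding power2_eq_square sum_product sum_divide_distrib by (intro sum.cong refl) (simp add: field_simps)
  have split: "(\<Sum>i<n. \<Sum>j<n. x i * A' i j * x j)
      = (\<Sum>i<Suc n. \<Sum>j<Suc n. x i * A i j * x j) - (\<Sum>i<Suc n. A i n * x i)\<^sup>2 / d" for x
  proof -
    have "(\<Sum>i<n. \<Sum>j<n. x i * A' i j * x j) = (\<Sum>i<Suc n. \<Sum>j<Suc n. x i * A' i j * x j)"
      by (simp add: last)
    also have "\<dots> = (\<Sum>i<Suc n. \<Sum>j<Suc n. x i * A i j * x j)
        - (\<Sum>i<Suc n. \<Sum>j<Suc n. x i * (A i n * A j n / d) * x j)"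
      unfolding sum_subtractf[symmetric] by (intro sum.cong refl) (simp add: A'_def algebra_simps)
    finally show ?thesis unfolding sq .
  qed
  have psd': "0 \<le> (\<Sum>i<n. \<Sum>j<n. x i * A' i j * x j)" for x
  proof -
    define y where "y = x(n := - (\<Sum>i<n. A i n * x i) / d)"
    have "(\<Sum>i<Suc n. A i n * y i) = 0 \<or> d = 0" by (auto simp: y_def d_def)
    moreover have "(\<Sum>i<n. \<Sum>j<n. x i * A' i j * x j) = (\<Sum>i<n. \<Sum>j<n. y i * A' i j * y j)"
      by (simp add: y_def)
    ultimately show ?thesis using split[of y] Suc.prems(2)[of y] by auto
  qed
  have psdB: "0 \<le> (\<Sum>i<n. \<Sum>j<n. x i * B i j * x j)" for x
    using Suc.prems(3)[of "x(n := 0)"] by simp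
  have dge: "0 \<le> d"
  proof -
    define x where "x = (\<lambda>i. if i = n then 1 else (0::real))"
    have "(\<Sum>i<Suc n. \<Sum>j<Suc n. x i * A i j * x j) = d" by (simp add: x_def d_def)
    then show ?thesis using Suc.prems(2)[of x] by simp
  qed
  have "A' i j = A' j i" for i j using Suc.prems(1)[of i j] by (simp add: A'_def)
  from Suc.IH[OF this psd' psdB] have "0 \<le> (\<Sum>i<n. \<Sum>j<n. A' i j * B i j)" .
  also have "\<dots> = (\<Sum>i<Suc n. \<Sum>j<Suc n. A' i j * B i j)" by (simp add: last)
  also have "\<dots> = (\<Sum>i<Suc n. \<Sum>j<Suc n. A i j * B i j)
      - (\<Sum>i<Suc n. \<Sum>j<Suc n. A i n * B i j * A j n) / d"
    unfolding sum_divide_distrib sum_subtractf[symmetric]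
    by (intro sum.cong refl) (simp add: A'_def algebra_simps)
  finally show ?case
    using divide_nonneg_nonneg[OF Suc.prems(3)[of "\<lambda>i. A i n"] dge] by linarith
qed

lemma quad_form_eq:
  assumes "A \<in> carrier_mat n n" "x \<in> carrier_vec n"
  shows "x \<bullet> (A *\<^sub>v x) = (\<Sum>i<n. \<Sum>j<n. x $ i * A $$ (i, j) * (x $ j :: real))"
  using assms by (auto simp: scalar_prod_def lessThan_atLeast0 sum_distrib_left mult.assoc intro!: sum.cong)

lemma mat_trace_mult_eq:
  assumes "A \<in> carrier_mat n m" "B \<in> carrier_mat m n"
  shows "mat_trace (A * B) = (\<Sum>i<n. \<Sum>j<m. A $$ (i, j) * B $$ (j, i))"
  using assms by (auto simp: mat_trace_def scalar_prod_def lessThan_atLeast0 intro!: sum.cong)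

lemma mat_trace_mult_comm:
  assumes "A \<in> carrier_mat n m" "B \<in> carrier_mat m n"
  shows "mat_trace (A * B) = mat_trace (B * A)"
  unfolding mat_trace_mult_eq[OF assms] mat_trace_mult_eq[OF assms(2,1)]
  by (subst sum.swap) (simp add: mult.commute)

lemma sym_mats_index:
  assumes "A \<in> sym_mats n" "i < n" "j < n"
  shows "A $$ (i, j) = A $$ (j, i)"
proof -
  have "transpose_mat A $$ (i, j) = A $$ (j, i)"
    using assms by (intro index_transpose_mat) (auto simp: sym_mats_def)
  moreover have "transpose_mat A = A" using assms by (simp add: sym_mats_def)
  ultimately show ?thesis by simp
qed

lemma psd_mats_trace_nonneg:
  assumes A: "A \<in> psd_mats n" and B: "B \<in> psd_mats n"
  shows "0 \<le> mat_trace (A * B)"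
proof -
  have AS: "A \<in> sym_mats n" and BS: "B \<in> sym_mats n" using A B by (auto simp: psd_mats_def)
  then have car: "A \<in> carrier_mat n n" "B \<in> carrier_mat n n" by (auto simp: sym_mats_def)
  define f where "f = (\<lambda>i j. if i < n \<and> j < n then A $$ (i, j) else 0)"
  have fun_psd: "0 \<le> (\<Sum>i<n. \<Sum>j<n. x i * C $$ (i, j) * x j)" if C: "C \<in> psd_mats n" for C x
  proof -
    have "C \<in> carrier_mat n n" using C by (auto simp: psd_mats_def sym_mats_def)
    from quad_form_eq[OF this, of "vec n x"]
    have "vec n x \<bullet> (C *\<^sub>v vec n x) = (\<Sum>i<n. \<Sum>j<n. x i * C $$ (i, j) * x j)" by simp
    moreover have "0 \<le> vec n x \<bullet> (C *\<^sub>v vec n x)" using C by (auto simp: psd_mats_def)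
    ultimately show ?thesis by simp
  qed
  have f_sym: "f i j = f j i" for i j
    using sym_mats_index[OF AS, of i j] by (auto simp: f_def)
  have f_psd: "0 \<le> (\<Sum>i<n. \<Sum>j<n. x i * f i j * x j)" for x
    using fun_psd[OF A, of x] by (simp add: f_def)
  have "0 \<le> (\<Sum>i<n. \<Sum>j<n. f i j * B $$ (i, j))"
    by (rule psd_fun_inner_nonneg[OF f_sym f_psd fun_psd[OF B]])
  also have "\<dots> = mat_trace (A * B)"
    unfolding mat_trace_mult_eq[OF car]
    by (intro sum.cong refl) (auto simp: f_def sym_mats_index[OF BS])
  finally show ?thesis .
qed

lemma block_rows2_carrier:
  "block_rows2 \<alpha> i j \<in> carrier_mat (\<alpha> ! i + \<alpha> ! j) (sum_list \<alpha>)"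
  unfolding block_rows2_def by (rule carrier_append_rows) (auto simp: block_row_def)

lemma congruence_sym:
  assumes E: "E \<in> carrier_mat m n" and X: "X \<in> sym_mats n"
  shows "E * X * transpose_mat E \<in> sym_mats m"
proof -
  have Xc: "X \<in> carrier_mat n n" and Xt: "transpose_mat X = X" using X by (auto simp: sym_mats_def)
  have "transpose_mat (E * X * transpose_mat E) = transpose_mat (transpose_mat E) * transpose_mat (E * X)"
    using E Xc by (intro transpose_mult) auto
  also have "transpose_mat (E * X) = X * transpose_mat E"
    using transpose_mult[OF E Xc] Xt by simp
  finally show ?thesis using E Xc by (auto simp: sym_mats_def)
qed

lemma trace_congruence:
  assumes E: "E \<in> carrier_mat m n" and X: "X \<in> carrier_mat n n" and Y: "Y \<in> carrier_mat m m"
  shows "mat_trace (X * (transpose_mat E * Y * E)) = mat_trace (E * X * transpose_mat E * Y)"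
proof -
  have "X * (transpose_mat E * Y * E) = X * transpose_mat E * Y * E"
    using E X Y by (simp add: assoc_mult_mat[of _ n n _ m _ n]
      assoc_mult_mat[of _ n m _ m _ n] assoc_mult_mat[of _ n n _ m _ m])
  moreover have "E * X * transpose_mat E * Y = E * (X * transpose_mat E * Y)"
    using E X Y by (simp add: assoc_mult_mat[of _ m n _ n _ m]
      assoc_mult_mat[of _ m n _ m _ m] assoc_mult_mat[of _ m n _ n _ m])
  moreover have "X * transpose_mat E * Y \<in> carrier_mat n m" using E X Y by auto
  ultimately show ?thesis using mat_trace_mult_comm[OF _ E] by simp
qed

lemma outer_quad_form:
  assumes A: "A \<in> carrier_mat n n" and x: "(x :: real vec) \<in> carrier_vec n"
  shows "mat_trace (A * mat n n (\<lambda>(r, c). x $ r * x $ c)) = x \<bullet> (A *\<^sub>v x)"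
  unfolding quad_form_eq[OF A x]
  by (subst mat_trace_mult_eq[OF A, of "mat n n (\<lambda>(r, c). x $ r * x $ c)"])
    (auto intro!: sum.cong)

lemma outer_psd:
  assumes x: "x \<in> carrier_vec n"
  shows "mat n n (\<lambda>(r, c). x $ r * x $ c) \<in> psd_mats n" (is "?Y \<in> _")
proof -
  have "0 \<le> y \<bullet> (?Y *\<^sub>v y)" if y: "y \<in> carrier_vec n" for y
  proof -
    have "y \<bullet> (?Y *\<^sub>v y) = (\<Sum>i<n. y $ i * x $ i) * (\<Sum>j<n. y $ j * x $ j)"
      unfolding sum_product by (subst quad_form_eq[OF _ y]) (auto intro!: sum.cong)
    then show ?thesis by simp
  qed
  then show ?thesis by (auto simp: psd_mats_def sym_mats_def)
qed

lemma zero_psd: "0\<^sub>m n n \<in> psd_mats n"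
proof -
  have "mat n n (\<lambda>(r, c). 0\<^sub>v n $ r * 0\<^sub>v n $ c) = (0\<^sub>m n n :: real mat)" by (intro eq_matI) auto
  then show ?thesis using outer_psd[of "0\<^sub>v n" n] by simp
qed

lemma fw2_sum_in_sym:
  assumes "\<forall>j < length \<alpha>. \<forall>i < j. X i j \<in> psd_mats (\<alpha> ! i + \<alpha> ! j)"
  shows "mat (sum_list \<alpha>) (sum_list \<alpha>) (\<lambda>(r, c). \<Sum>j < length \<alpha>. \<Sum>i < j.
       (transpose_mat (block_rows2 \<alpha> i j) * X i j * block_rows2 \<alpha> i j) $$ (r, c))
     \<in> sym_mats (sum_list \<alpha>)" (is "mat ?n ?n ?f \<in> _")
proof -
  have "transpose_mat (block_rows2 \<alpha> i j) * X i j * block_rows2 \<alpha> i j \<in> sym_mats ?n"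
    if "i < j" "j < length \<alpha>" for i j
    using congruence_sym[of "transpose_mat (block_rows2 \<alpha> i j)" ?n _ "X i j"]
      block_rows2_carrier[of \<alpha> i j] assms that by (auto simp: psd_mats_def)
  then have "?f (r, c) = ?f (c, r)" if "r < ?n" "c < ?n" for r c
    using that by (auto intro!: sum.cong sym_mats_index)
  then show ?thesis unfolding sym_mats_def by (intro CollectI conjI eq_matI) auto
qed

lemma dual_fw2_eq:
  "dual_cone (sum_list \<alpha>) (fw2 \<alpha>) = {X \<in> sym_mats (sum_list \<alpha>).
     \<forall>j < length \<alpha>. \<forall>i < j.
       block_rows2 \<alpha> i j * X * transpose_mat (block_rows2 \<alpha> i j) \<in> psd_mats (\<alpha> ! i + \<alpha> ! j)}"
proof -
  let ?n = "sum_list \<alpha>" and ?p = "length \<alpha>"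
  let ?E = "block_rows2 \<alpha>"
  let ?G = "\<lambda>Y i j. transpose_mat (?E i j) * Y i j * ?E i j"
  let ?Z = "\<lambda>Y. mat ?n ?n (\<lambda>(r, c). \<Sum>j<?p. \<Sum>i<j. ?G Y i j $$ (r, c))"
  note Ec = block_rows2_carrier[of \<alpha>]
  have tr: "mat_trace (X * ?Z Y) = (\<Sum>j<?p. \<Sum>i<j. mat_trace (?E i j * X * transpose_mat (?E i j) * Y i j))"
    if X: "X \<in> sym_mats ?n" and Y: "\<forall>j < ?p. \<forall>i < j. Y i j \<in> psd_mats (\<alpha> ! i + \<alpha> ! j)" for X Y
  proof -
    have Xc: "X \<in> carrier_mat ?n ?n" using X by (simp add: sym_mats_def)
    have "mat_trace (X * ?Z Y) = (\<Sum>r<?n. \<Sum>c<?n. X $$ (r, c) * (\<Sum>j<?p. \<Sum>i<j. ?G Y i j $$ (c, r)))"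
      by (subst mat_trace_mult_eq[OF Xc]) auto
    also have "\<dots> = (\<Sum>r<?n. \<Sum>c<?n. \<Sum>j<?p. \<Sum>i<j. X $$ (r, c) * ?G Y i j $$ (c, r))"
      by (simp add: sum_distrib_left)
    also have "\<dots> = (\<Sum>r<?n. \<Sum>j<?p. \<Sum>c<?n. \<Sum>i<j. X $$ (r, c) * ?G Y i j $$ (c, r))"
      by (intro sum.cong refl sum.swap)
    also have "\<dots> = (\<Sum>j<?p. \<Sum>r<?n. \<Sum>c<?n. \<Sum>i<j. X $$ (r, c) * ?G Y i j $$ (c, r))"
      by (rule sum.swap)
    also have "\<dots> = (\<Sum>j<?p. \<Sum>r<?n. \<Sum>i<j. \<Sum>c<?n. X $$ (r, c) * ?G Y i j $$ (c, r))"
      by (intro sum.cong refl sum.swap)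
    also have "\<dots> = (\<Sum>j<?p. \<Sum>i<j. \<Sum>r<?n. \<Sum>c<?n. X $$ (r, c) * ?G Y i j $$ (c, r))"
      by (intro sum.cong refl sum.swap)
    also have "\<dots> = (\<Sum>j<?p. \<Sum>i<j. mat_trace (?E i j * X * transpose_mat (?E i j) * Y i j))"
    proof (intro sum.cong refl)
      fix i j assume "j \<in> {..<?p}" "i \<in> {..<j}"
      then have Yc: "Y i j \<in> carrier_mat (\<alpha> ! i + \<alpha> ! j) (\<alpha> ! i + \<alpha> ! j)"
        using Y by (auto simp: psd_mats_def sym_mats_def)
      then have "?G Y i j \<in> carrier_mat ?n ?n" using Ec[of i j] by auto
      from mat_trace_mult_eq[OF Xc this] trace_congruence[OF Ec Xc Yc]
      show "(\<Sum>r<?n. \<Sum>c<?n. X $$ (r, c) * ?G Y i j $$ (c, r))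
        = mat_trace (?E i j * X * transpose_mat (?E i j) * Y i j)" by simp
    qed
    finally show ?thesis .
  qed
  have "?E i j * X * transpose_mat (?E i j) \<in> psd_mats (\<alpha> ! i + \<alpha> ! j)"
    if X: "X \<in> dual_cone ?n (fw2 \<alpha>)" and ij: "i < j" "j < ?p" for X i j
  proof -
    let ?m = "\<alpha> ! i + \<alpha> ! j" and ?A = "?E i j * X * transpose_mat (?E i j)"
    have XS: "X \<in> sym_mats ?n" using X by (simp add: dual_cone_def)
    have AS: "?A \<in> sym_mats ?m" by (rule congruence_sym[OF Ec XS])
    then have Ac: "?A \<in> carrier_mat ?m ?m" by (simp add: sym_mats_def)
    have "0 \<le> x \<bullet> (?A *\<^sub>v x)" if x: "x \<in> carrier_vec ?m" for x
    proof -
      let ?o = "mat ?m ?m (\<lambda>(r, c). x $ r * x $ c)"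
      define Y where "Y = (\<lambda>k l. if k = i \<and> l = j then ?o else 0\<^sub>m (\<alpha> ! k + \<alpha> ! l) (\<alpha> ! k + \<alpha> ! l))"
      have Y: "\<forall>l < ?p. \<forall>k < l. Y k l \<in> psd_mats (\<alpha> ! k + \<alpha> ! l)"
        using outer_psd[OF x] zero_psd by (auto simp: Y_def)
      have "?Z Y \<in> fw2 \<alpha>" unfolding fw2_def using Y fw2_sum_in_sym[OF Y] by blast
      then have "0 \<le> mat_trace (X * ?Z Y)" using X by (auto simp: dual_cone_def)
      also have "\<dots> = (\<Sum>l<?p. \<Sum>k<l. mat_trace (?E k l * X * transpose_mat (?E k l) * Y k l))"
        by (rule tr[OF XS Y])
      also have "\<dots> = (\<Sum>l<?p. if l = j then mat_trace (?A * ?o) else 0)"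
      proof (intro sum.cong refl)
        fix l assume "l \<in> {..<?p}"
        have "mat_trace (?E k l * X * transpose_mat (?E k l) * Y k l)
          = (if k = i then if l = j then mat_trace (?A * ?o) else 0 else 0)" for k
        proof (cases "k = i \<and> l = j")
          case False
          have "?E k l * X * transpose_mat (?E k l) \<in> carrier_mat (\<alpha> ! k + \<alpha> ! l) (\<alpha> ! k + \<alpha> ! l)"
            using congruence_sym[OF Ec XS] by (simp add: sym_mats_def)
          then show ?thesis using False by (auto simp: Y_def mat_trace_def)
        qed (auto simp: Y_def)
        then show "(\<Sum>k<l. mat_trace (?E k l * X * transpose_mat (?E k l) * Y k l))
          = (if l = j then mat_trace (?A * ?o) else 0)" using ij by simp
      qed
      also have "\<dots> = x \<bullet> (?A *\<^sub>v x)" using ij outer_quad_form[OF Ac x] by simp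
      finally show ?thesis .
    qed
    then show ?thesis using AS by (simp add: psd_mats_def)
  qed
  moreover have "X \<in> dual_cone ?n (fw2 \<alpha>)"
    if XS: "X \<in> sym_mats ?n"
      and A: "\<forall>j < ?p. \<forall>i < j. ?E i j * X * transpose_mat (?E i j) \<in> psd_mats (\<alpha> ! i + \<alpha> ! j)" for X
  proof -
    have "0 \<le> mat_trace (X * Z)" if "Z \<in> fw2 \<alpha>" for Z
    proof -
      from that obtain Y where Y: "\<forall>j < ?p. \<forall>i < j. Y i j \<in> psd_mats (\<alpha> ! i + \<alpha> ! j)"
        and Z: "Z = ?Z Y" unfolding fw2_def by blast
      show ?thesis unfolding Z tr[OF XS Y] using A Y
        by (intro sum_nonneg psd_mats_trace_nonneg) auto
    qed
    then show ?thesis using XS by (simp add: dual_cone_def)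
  qed
  ultimately show ?thesis by (auto simp: dual_cone_def)
qed

text \<open>Infima and suprema over \<open>real\<close> are meaningful only for bounded nonempty sets; the bounds hold
  because \<open>frob_norm\<close> is nonnegative and the zero matrix is positive semidefinite.\<close>

lemma frob_norm_nonneg: "0 \<le> frob_norm A"
  by (auto simp: frob_norm_def intro!: sum_nonneg)

lemma bdd_below_mat_dist: "bdd_below ((\<lambda>N. frob_norm (M - N)) ` D)"
  by (rule bdd_belowI2[of _ 0]) (rule frob_norm_nonneg)

lemma bdd_above_cone_dist:
  assumes "C \<subseteq> sym_mats n"
  shows "bdd_above ((\<lambda>M. mat_dist M (psd_mats n)) ` {M \<in> C. frob_norm M = 1})"
proof (rule bdd_aboveI2[of _ _ 1])
  fix M assume M: "M \<in> {M \<in> C. frob_norm M = 1}"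
  have "mat_dist M (psd_mats n) \<le> frob_norm (M - 0\<^sub>m n n)"
    unfolding mat_dist_def by (rule cINF_lower[OF bdd_below_mat_dist zero_psd])
  also have "M - 0\<^sub>m n n = M"
  proof -
    have "M \<in> carrier_mat n n" using M assms by (auto simp: sym_mats_def)
    then show ?thesis by (intro eq_matI) auto
  qed
  finally show "mat_dist M (psd_mats n) \<le> 1" using M by simp
qed

end

theory Submission
  imports Defs "HOL-Analysis.L2_Norm"
begin

text \<open>On the first coordinates of the \<open>p\<close> blocks put \<open>(2 I - J) / p\<close>, where \<open>J\<close> is the all-ones
  matrix, and put zeros elsewhere. This matrix has Frobenius norm 1, and compressing it to two
  blocks gives the rank-one matrix with vector \<open>(e - e') / sqrt p\<close>, so it lies in the dual cone. Its
  quadratic form at the unit vector \<open>u\<close> spread evenly over these coordinates is \<open>(2 - p) / p\<close>; since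
  the quadratic form at \<open>u\<close> is nonnegative on the PSD cone and 1-Lipschitz in the Frobenius norm, the
  distance to the cone is at least \<open>(p - 2) / p\<close>. The first factor of the claimed bound is at most 1.\<close>

text \<open>With blocks of equal size \<open>k\<close>, block \<open>m\<close> starts at index
  \<open>m * k\<close>, so divisibility by \<open>k\<close> marks the first coordinate of each
  block.\<close>

definition lead_indicator :: "nat \<Rightarrow> nat \<Rightarrow> real" where
  "lead_indicator k r = (if k dvd r then 1 else 0)"

definition witness_mat :: "nat \<Rightarrow> nat \<Rightarrow> real mat" where
  "witness_mat p k = mat (p * k) (p * k) (\<lambda>(r, c).
     lead_indicator k r * lead_indicator k c * (if r = c then 1 else - 1) / real p)"

lemma homogeneous_eq_replicate:
  assumes "homogeneous \<alpha>"
  shows "\<alpha> = replicate (length \<alpha>) (\<alpha> ! 0)"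
  using assms by (intro nth_equalityI) (auto simp: homogeneous_def)

text \<open>Each of the \<open>p\<close> consecutive intervals of length \<open>k\<close> contains
  exactly one multiple of \<open>k\<close>, its left end; \<open>sum.nat_group\<close> cuts the
  range into these intervals.\<close>

lemma sum_lead_indicator:
  assumes "0 < k"
  shows "(\<Sum>r<p * k. lead_indicator k r) = real p"
proof -
  have "(\<Sum>r\<in>{m * k..<m * k + k}. lead_indicator k r) = 1" for m
  proof -
    have "(\<Sum>r\<in>{m * k..<m * k + k}. lead_indicator k r)
        = (\<Sum>r\<in>{m * k..<m * k + k}. if r = m * k then 1 else 0)"
    proof (intro sum.cong refl)
      fix r assume r: "r \<in> {m * k..<m * k + k}"
      then obtain s where "r = m * k + s" "s < k"
        by (metis atLeastLessThan_iff le_Suc_ex nat_add_left_cancel_less)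
      then have "k dvd r \<longleftrightarrow> r = m * k" by (auto dest: dvd_imp_le)
      then show "lead_indicator k r = (if r = m * k then 1 else 0)"
        by (simp add: lead_indicator_def)
    qed
    then show ?thesis using assms by simp
  qed
  then show ?thesis unfolding sum.nat_group[symmetric] by simp
qed

lemma lead_indicator_sq [simp]: "(lead_indicator k r)\<^sup>2 = lead_indicator k r"
  by (simp add: lead_indicator_def)

text \<open>Cauchy-Schwarz: the quadratic form is the Frobenius inner product of \<open>A\<close>
  with the outer product of \<open>x\<close> with itself, whose Frobenius norm is the squared length
  of \<open>x\<close>. Applied to a difference of matrices, this is the Lipschitz estimate.\<close>

lemma quad_form_le_frob_norm:
  assumes A: "A \<in> carrier_mat n n" and x: "x \<in> carrier_vec n"
  shows "x \<bullet> (A *\<^sub>v x) \<le> frob_norm A * (\<Sum>i<n. (x $ i)\<^sup>2)"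
proof -
  let ?I = "{..<n} \<times> {..<n}"
  have "x \<bullet> (A *\<^sub>v x) = (\<Sum>q\<in>?I. A $$ q * (x $ fst q * x $ snd q))"
    unfolding quad_form_eq[OF A x] sum.cartesian_product
    by (intro sum.cong refl) (simp add: case_prod_beta mult_ac)
  also have "\<dots> \<le> (\<Sum>q\<in>?I. \<bar>A $$ q\<bar> * \<bar>x $ fst q * x $ snd q\<bar>)"
    unfolding abs_mult[symmetric] by (intro sum_mono abs_ge_self)
  also have "\<dots> \<le> L2_set (\<lambda>q. A $$ q) ?I * L2_set (\<lambda>q. x $ fst q * x $ snd q) ?I"
    by (rule L2_set_mult_ineq)
  also have "L2_set (\<lambda>q. A $$ q) ?I = frob_norm A"
    using A by (simp add: L2_set_def frob_norm_def sum.cartesian_product case_prod_beta)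
  also have "L2_set (\<lambda>q. x $ fst q * x $ snd q) ?I = (\<Sum>i<n. (x $ i)\<^sup>2)"
  proof -
    have "(\<Sum>q\<in>?I. (x $ fst q * x $ snd q)\<^sup>2) = (\<Sum>i<n. (x $ i)\<^sup>2) * (\<Sum>j<n. (x $ j)\<^sup>2)"
      by (simp add: sum_product sum.cartesian_product case_prod_beta power_mult_distrib)
    then show ?thesis by (simp add: L2_set_def sum_nonneg)
  qed
  finally show ?thesis .
qed

lemma witness_mat_carrier: "witness_mat p k \<in> carrier_mat (p * k) (p * k)"
  by (simp add: witness_mat_def)

text \<open>There are \<open>p * p\<close> nonzero entries, one for each pair of blocks, and each
  has absolute value \<open>1 / p\<close>.\<close>

lemma frob_norm_witness_mat:
  assumes "0 < k" "0 < p"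
  shows "frob_norm (witness_mat p k) = 1"
proof -
  have "(\<Sum>i<p * k. \<Sum>j<p * k. (witness_mat p k $$ (i, j))\<^sup>2)
      = (\<Sum>i<p * k. \<Sum>j<p * k. lead_indicator k i * lead_indicator k j / (real p)\<^sup>2)"
    by (intro sum.cong refl) (auto simp: witness_mat_def power_mult_distrib power_divide)
  also have "\<dots> = (\<Sum>i<p * k. lead_indicator k i) * (\<Sum>j<p * k. lead_indicator k j) / (real p)\<^sup>2"
    by (simp add: sum_product sum_divide_distrib)
  also have "\<dots> = 1" using assms by (simp add: sum_lead_indicator power2_eq_square)
  finally show ?thesis by (simp add: frob_norm_def witness_mat_def)
qed

text \<open>The vector \<open>w\<close> is left unnormalised, with squared length \<open>p\<close>,
  so the value is \<open>p\<close> times the one at the unit vector.\<close>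

lemma witness_mat_quad_form:
  fixes p k :: nat
  defines "w \<equiv> vec (p * k) (lead_indicator k)"
  assumes "0 < k" "0 < p"
  shows "w \<bullet> (witness_mat p k *\<^sub>v w) = 2 - real p"
proof -
  have "w \<bullet> (witness_mat p k *\<^sub>v w)
      = (\<Sum>i<p * k. \<Sum>j<p * k. w $ i * witness_mat p k $$ (i, j) * w $ j)"
    by (rule quad_form_eq[OF witness_mat_carrier]) (simp add: w_def)
  \<comment> \<open>The sign is split as twice the Kronecker delta minus 1, and indicators are
    idempotent; the two parts come from \<open>2 I\<close> and \<open>- J\<close>.\<close>
  also have "\<dots> = (\<Sum>i<p * k. \<Sum>j<p * k. (if i = j then 2 * lead_indicator k i / real p else 0)
        - lead_indicator k i * lead_indicator k j / real p)"
    by (intro sum.cong refl) (auto simp: witness_mat_def w_def lead_indicator_def)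
  also have "\<dots> = 2 * (\<Sum>i<p * k. lead_indicator k i) / real p
      - (\<Sum>i<p * k. lead_indicator k i) * (\<Sum>j<p * k. lead_indicator k j) / real p"
    unfolding sum_product
    by (simp add: sum_subtractf sum_divide_distrib[symmetric] sum_distrib_left[symmetric])
  also have "\<dots> = 2 - real p" using assms by (simp add: sum_lead_indicator)
  finally show ?thesis .
qed

lemma block_rows2_replicate_index:
  assumes "i < p" "j < p" "r < k + k" "c < p * k"
  shows "block_rows2 (replicate p k) i j $$ (r, c)
    = (if c = (if r < k then i * k + r else j * k + (r - k)) then 1 else 0)"
proof -
  \<comment> \<open>Keeps the row index inside the identity matrix, whose entries are known only
    within its dimensions.\<close>
  have lt: "l * k + s < p * k" if "l < p" "s < k" for l s
  proof -
    have "l * k + s < Suc l * k" using that by simp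
    also have "\<dots> \<le> p * k" using that by (intro mult_le_mono1) simp
    finally show ?thesis .
  qed
  show ?thesis using assms lt[of i r] lt[of j "r - k"]
    by (auto simp: block_rows2_def append_rows_def block_row_def sum_list_replicate min_def)
qed

text \<open>By \<open>dual_fw2_eq\<close> it suffices to examine the compressions. Each is a
  principal submatrix on two blocks, supported on their two leading coordinates, where it has
  diagonal \<open>1 / p\<close> and off-diagonal \<open>- 1 / p\<close>.\<close>

lemma witness_mat_in_dual:
  assumes k: "0 < k"
  shows "witness_mat p k \<in> dual_cone (p * k) (fw2 (replicate p k))"
proof -
  let ?\<alpha> = "replicate p k" and ?M = "witness_mat p k"
  have n: "sum_list ?\<alpha> = p * k" by (simp add: sum_list_replicate)
  have "block_rows2 ?\<alpha> i j * ?M * transpose_mat (block_rows2 ?\<alpha> i j) \<in> psd_mats (k + k)"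
    if ij: "i < j" "j < p" for i j
  proof -
    let ?E = "block_rows2 ?\<alpha> i j"
    have E: "?E \<in> carrier_mat (k + k) (p * k)" using block_rows2_carrier[of ?\<alpha> i j] ij n by simp
    \<comment> \<open>Row \<open>r\<close> of \<open>?E\<close> is the unit row at coordinate
      \<open>f r\<close>, so compression by \<open>?E\<close> reads off the entries of
      \<open>?M\<close> at \<open>(f r, f c)\<close>.\<close>
    define f where "f = (\<lambda>r. if r < k then i * k + r else j * k + (r - k))"
    \<comment> \<open>Local positions \<open>0\<close> and \<open>k\<close> are the leading
      coordinates of the two blocks; the square root shares the factor \<open>1 / p\<close> between
      the two copies of \<open>z\<close>.\<close>
    define z where "z = vec (k + k) (\<lambda>r. (if r = 0 then 1 else if r = k then - 1 else 0) / sqrt (real p))"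
    have f_lt: "f r < p * k" if "r < k + k" for r
    proof -
      have "f r < Suc (if r < k then i else j) * k" using that by (auto simp: f_def)
      also have "\<dots> \<le> p * k" using ij by (intro mult_le_mono1) simp
      finally show ?thesis .
    qed
    have E_index: "?E $$ (r, c) = (if c = f r then 1 else 0)" if "r < k + k" "c < p * k" for r c
      using block_rows2_replicate_index[of i p j r k c] ij that by (simp add: f_def)
    have lead: "lead_indicator k (f r) = (if r = 0 \<or> r = k then 1 else 0)" if r: "r < k + k" for r
    proof (cases "r < k")
      case True
      then show ?thesis by (auto simp: lead_indicator_def f_def dest: dvd_imp_le)
    next
      case False
      then obtain s where "r = k + s" "s < k" using r by (metis le_Suc_ex nat_add_left_cancel_less not_less)
      then show ?thesis using k by (auto simp: lead_indicator_def f_def dest: dvd_imp_le)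
    qed
    have "?E * ?M * transpose_mat ?E = mat (k + k) (k + k) (\<lambda>(r, c). z $ r * z $ c)"
    proof (rule eq_matI)
      fix r c
      assume "r < dim_row (mat (k + k) (k + k) (\<lambda>(r, c). z $ r * z $ c))"
        "c < dim_col (mat (k + k) (k + k) (\<lambda>(r, c). z $ r * z $ c))"
      then have rc: "r < k + k" "c < k + k" by auto
      have EM: "(?E * ?M) $$ (r, b) = ?M $$ (f r, b)" if "b < p * k" for b
      proof -
        have "(?E * ?M) $$ (r, b) = (\<Sum>a<p * k. ?E $$ (r, a) * ?M $$ (a, b))"
          using E witness_mat_carrier[of p k] rc that
          by (auto simp: scalar_prod_def lessThan_atLeast0 intro!: sum.cong)
        also have "\<dots> = (\<Sum>a<p * k. if a = f r then ?M $$ (a, b) else 0)"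
          by (intro sum.cong) (auto simp: E_index rc)
        finally show ?thesis using f_lt rc by simp
      qed
      have "(?E * ?M * transpose_mat ?E) $$ (r, c) = (\<Sum>b<p * k. (?E * ?M) $$ (r, b) * ?E $$ (c, b))"
        using E witness_mat_carrier[of p k] rc
        by (auto simp: scalar_prod_def lessThan_atLeast0 simp del: assoc_mult_mat intro!: sum.cong)
      also have "\<dots> = (\<Sum>b<p * k. if b = f c then ?M $$ (f r, b) else 0)"
        by (intro sum.cong) (auto simp: E_index rc EM)
      also have "\<dots> = ?M $$ (f r, f c)" using f_lt rc by simp
      \<comment> \<open>Away from the leading positions both sides vanish. At them the diagonal test
        \<open>f r = f c\<close> agrees with \<open>r = c\<close>, since \<open>i * k\<close> and
        \<open>j * k\<close> differ for \<open>i < j\<close> and \<open>0 < k\<close>.\<close>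
      also have "\<dots> = z $ r * z $ c"
        using rc f_lt ij k by (auto simp: witness_mat_def lead z_def) (auto simp: f_def)
      finally show "(?E * ?M * transpose_mat ?E) $$ (r, c)
          = mat (k + k) (k + k) (\<lambda>(r, c). z $ r * z $ c) $$ (r, c)" using rc by simp
    qed (use E in auto)
    then show ?thesis using outer_psd[of z "k + k"] by (simp add: z_def)
  qed
  moreover have "?M \<in> sym_mats (p * k)"
    by (auto simp: sym_mats_def witness_mat_def intro!: eq_matI)
  ultimately show ?thesis using dual_fw2_eq[of ?\<alpha>] n by auto
qed

lemma mat_dist_witness_mat_ge:
  assumes "0 < k" "0 < p"
  shows "(real p - 2) / real p \<le> mat_dist (witness_mat p k) (psd_mats (p * k))"
  unfolding mat_dist_def
proof (rule cINF_greatest)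
  show "psd_mats (p * k) \<noteq> {}" using zero_psd by blast
next
  fix N assume N: "N \<in> psd_mats (p * k)"
  let ?M = "witness_mat p k" and ?w = "vec (p * k) (lead_indicator k)"
  note Mc = witness_mat_carrier[of p k]
  have Nc: "N \<in> carrier_mat (p * k) (p * k)" using N by (simp add: psd_mats_def sym_mats_def)
  have w: "?w \<in> carrier_vec (p * k)" by simp
  have D: "N - ?M \<in> carrier_mat (p * k) (p * k)" using Mc by (rule minus_carrier_mat)
  \<comment> \<open>The form of \<open>N\<close> is nonnegative at \<open>?w\<close>, while that of
    \<open>?M\<close> is \<open>2 - p\<close>. Taking \<open>N - ?M\<close> in this order makes the
    gap positive for \<open>p > 2\<close>.\<close>
  have "real p - 2 \<le> ?w \<bullet> (N *\<^sub>v ?w) - ?w \<bullet> (?M *\<^sub>v ?w)"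
    using N w witness_mat_quad_form[OF assms] by (auto simp: psd_mats_def)
  also have "\<dots> = ?w \<bullet> ((N - ?M) *\<^sub>v ?w)"
    unfolding quad_form_eq[OF Nc w] quad_form_eq[OF Mc w] quad_form_eq[OF D w]
      sum_subtractf[symmetric]
    using Nc Mc by (intro sum.cong refl) (auto simp: algebra_simps)
  also have "\<dots> \<le> frob_norm (N - ?M) * (\<Sum>i<p * k. (?w $ i)\<^sup>2)"
    by (rule quad_form_le_frob_norm[OF D w])
  also have "frob_norm (N - ?M) = frob_norm (?M - N)"
    using Nc Mc by (auto simp: frob_norm_def power2_commute)
  also have "(\<Sum>i<p * k. (?w $ i)\<^sup>2) = real p" using sum_lead_indicator assms by simp
  finally show "(real p - 2) / real p \<le> frob_norm (?M - N)"
    using assms by (simp add: divide_le_eq)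
qed

theorem proposition3:
  fixes \<alpha> :: "nat list" and n p :: nat
  assumes "partition_of n \<alpha>"
    and "length \<alpha> = p"
    and "2 \<le> p"
    and "homogeneous \<alpha>"
  shows "cone_dist (dual_cone n (fw2 \<alpha>)) (psd_mats n)
    \<ge> 1 / sqrt (4 * real n / (real p)\<^sup>2 - 4 / real p + 1) * ((real p - 2) / real p)"
proof -
  define k where "k = \<alpha> ! 0"
  have \<alpha>: "\<alpha> = replicate p k"
    using homogeneous_eq_replicate[OF assms(4)] assms(2) by (simp add: k_def)
  have k: "0 < k" and n: "n = p * k"
    using assms(1,3) unfolding \<alpha> by (auto simp: partition_of_def sum_list_replicate)
  have p: "0 < p" using assms(3) by simp
  \<comment> \<open>Substituting \<open>n = p * k\<close> exposes the radicand as \<open>1\<close>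
    plus a multiple of \<open>k - 1\<close>, which is nonnegative because blocks are
    nonempty.\<close>
  have "4 * real n / (real p)\<^sup>2 - 4 / real p + 1 = 4 * (real k - 1) / real p + 1"
    using p by (simp add: n power2_eq_square field_simps)
  also have "\<dots> \<ge> 1" using k p by simp
  finally have D: "1 \<le> 4 * real n / (real p)\<^sup>2 - 4 / real p + 1" .
  then have "1 \<le> sqrt (4 * real n / (real p)\<^sup>2 - 4 / real p + 1)" by simp
  then have "1 / sqrt (4 * real n / (real p)\<^sup>2 - 4 / real p + 1) \<le> 1"
    using divide_le_eq_1 by fastforce
  \<comment> \<open>Dropping a factor at most 1 preserves the inequality because
    \<open>2 \<le> p\<close> makes \<open>(p - 2) / p\<close> nonnegative.\<close>
  then have "1 / sqrt (4 * real n / (real p)\<^sup>2 - 4 / real p + 1) * ((real p - 2) / real p)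
      \<le> (real p - 2) / real p"
    using assms(3) by (intro mult_left_le_one_le) (use D in auto)
  also have "\<dots> \<le> mat_dist (witness_mat p k) (psd_mats n)"
    unfolding n by (rule mat_dist_witness_mat_ge[OF k p])
  also have "\<dots> \<le> cone_dist (dual_cone n (fw2 \<alpha>)) (psd_mats n)"
    unfolding cone_dist_def
  proof (rule cSUP_upper)
    show "witness_mat p k \<in> {M \<in> dual_cone n (fw2 \<alpha>). frob_norm M = 1}"
      using witness_mat_in_dual[OF k] frob_norm_witness_mat[OF k p] by (simp add: \<alpha> n)
    \<comment> \<open>A real supremum dominates its members only for a set bounded above; here
      comparison with the zero matrix bounds every distance by 1.\<close>
    show "bdd_above ((\<lambda>M. mat_dist M (psd_mats n)) ` {M \<in> dual_cone n (fw2 \<alpha>). frob_norm M = 1})"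
      by (rule bdd_above_cone_dist) (auto simp: dual_cone_def)
  qed
  finally show ?thesis .
qed

end
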